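(* Let $0<\epsilon,\delta<1$ and suppose that each of the candidate distributions $\mathcal{C}_1,\dots,\mathcal{C}_K$ satisfies the $(\epsilon,\delta)$-lower deviation inequality. Then the mean-weighted allocation $\mathbf{v}$, given by $v_i=R\mu_i/Z$ for $1\le i\le K$, satisfies $$U(\mathbf{v},\{\mathcal{C}_i\})\ \ge\ \min(1-\delta,\,1-\epsilon-\delta)\cdot\max_{\mathbf{w}}U(\mathbf{w},\{\mathcal{C}_i\})=(1-\epsilon-\delta)\cdot\max_{\mathbf{w}}U(\mathbf{w},\{\mathcal{C}_i\}),$$ where the maximum is over all allocations $\mathbf{w}$.
   Context: There are $K\ge 1$ groups. For each group $i$, the number of candidates $C_i\ge 0$ is a real-valued random variable with distribution $\mathcal{C}_i$ and finite mean $\mu_i=\mathbb{E}[C_i]>0$; the $C_i$ are independent. Put $Z=\sum_{i=1}^K\mu_i$. There are $R$ units of resource, $R$ a positive integer. An allocation is a vector $\mathbf{w}=[w_1,\dots,w_K]$ of nonnegative reals (fractional allocations are allowed) with $\sum_i w_i=R$. Utilization: $U(\mathbf{w},\{\mathcal{C}_i\})=\sum_{i=1}^K\mathbb{E}[\min(C_i,w_i)]$. A random variable $X$ (or its distribution) satisfies the $(\epsilon,\delta)$-lower deviation inequality if $\Pr[X\le(1-\epsilon)\mathbb{E}[X]]\le\delta$. *)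

theory Defs
  imports "HOL-Probability.Probability"
begin

text \<open>
  Groups are indexed by a finite type \<open>'k\<close>, so \<open>K = CARD('k) \<ge> 1\<close> is arbitrary. The numbers of
  candidates are random variables \<open>C i\<close> on a common probability space \<open>M\<close>.
\<close>

definition allocations :: "nat \<Rightarrow> (real ^ 'k::finite) set" where
  "allocations R = {w. (\<forall>i. 0 \<le> w $ i) \<and> (\<Sum>i\<in>UNIV. w $ i) = real R}"

definition utilization :: "'a measure \<Rightarrow> ('k::finite \<Rightarrow> 'a \<Rightarrow> real) \<Rightarrow> real ^ 'k \<Rightarrow> real" where
  "utilization M C w = (\<Sum>i\<in>UNIV. prob_space.expectation M (\<lambda>\<omega>. min (C i \<omega>) (w $ i)))"

definition lower_deviation :: "'a measure \<Rightarrow> real \<Rightarrow> real \<Rightarrow> ('a \<Rightarrow> real) \<Rightarrow> bool" where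
  "lower_deviation M \<epsilon> \<delta> X \<longleftrightarrow>
     prob_space.prob M {\<omega> \<in> space M. X \<omega> \<le> (1 - \<epsilon>) * prob_space.expectation M X} \<le> \<delta>"

definition total_mean :: "'a measure \<Rightarrow> ('k::finite \<Rightarrow> 'a \<Rightarrow> real) \<Rightarrow> real" where
  "total_mean M C = (\<Sum>i\<in>UNIV. prob_space.expectation M (C i))"

definition mean_weighted :: "'a measure \<Rightarrow> ('k::finite \<Rightarrow> 'a \<Rightarrow> real) \<Rightarrow> nat \<Rightarrow> real ^ 'k" where
  "mean_weighted M C R = (\<chi> i. real R * prob_space.expectation M (C i) / total_mean M C)"

end

theory Submission
  imports Defs
begin

text \<open>
  Let \<open>t = R / Z\<close>. With probability at least \<open>1 - \<delta>\<close>, group \<open>i\<close> has more than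
  \<open>(1 - \<epsilon>) \<mu>\<^sub>i\<close> candidates, so the mean-weighted allocation satisfies
  \<open>E[min(C\<^sub>i, t \<mu>\<^sub>i)] \<ge> (1 - \<delta>) min(t, 1 - \<epsilon>) \<mu>\<^sub>i \<ge> (1 - \<delta>) (1 - \<epsilon>) min(t, 1) \<mu>\<^sub>i\<close>.
  Summing over \<open>i\<close> gives \<open>(1 - \<delta>) (1 - \<epsilon>) min(R, Z)\<close>, while \<open>min(R, Z)\<close> bounds the utilization
  of every allocation. The maximum is attained because utilization is continuous on the
  compact simplex of allocations.
\<close>

text \<open>The Euclidean norm is at most the l1 norm, which is \<open>real R\<close> on nonnegative
  vectors with that sum; closedness comes from the weak inequalities and the equation. Compactness
  serves to make the maximum exist.\<close>

lemma compact_allocations: "compact (allocations R :: (real ^ 'k::finite) set)"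
proof -
  have "norm w \<le> real R" if "w \<in> allocations R" for w :: "real ^ 'k"
    using norm_le_l1_cart[of w] that by (simp add: allocations_def)
  then have "bounded (allocations R :: (real ^ 'k) set)"
    by (auto simp: bounded_iff)
  moreover have "closed (allocations R :: (real ^ 'k) set)"
    unfolding allocations_def
    by (intro closed_Collect_conj closed_Collect_all closed_Collect_le closed_Collect_eq continuous_intros)
  ultimately show ?thesis
    by (simp add: compact_eq_bounded_closed)
qed

context prob_space
begin

lemma integrable_min_const:
  fixes X :: "'a \<Rightarrow> real"
  assumes "integrable M X"
  shows "integrable M (\<lambda>\<omega>. min (X \<omega>) s)"
  using assms by (intro integrable_min) auto

text \<open>For each fixed outcome, \<open>min (X \<omega>) s\<close> is 1-Lipschitz in
  \<open>s\<close>, and averaging over a probability measure keeps the constant 1.\<close>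

lemma continuous_on_expectation_min:
  fixes X :: "'a \<Rightarrow> real"
  assumes X: "integrable M X"
  shows "continuous_on UNIV (\<lambda>s. expectation (\<lambda>\<omega>. min (X \<omega>) s))"
proof -
  have "dist (expectation (\<lambda>\<omega>. min (X \<omega>) a)) (expectation (\<lambda>\<omega>. min (X \<omega>) b)) \<le> 1 * dist a b" for a b
  proof -
    have "\<bar>expectation (\<lambda>\<omega>. min (X \<omega>) a) - expectation (\<lambda>\<omega>. min (X \<omega>) b)\<bar>
        = \<bar>expectation (\<lambda>\<omega>. min (X \<omega>) a - min (X \<omega>) b)\<bar>"
      by (simp add: integrable_min_const X)
    also have "\<dots> \<le> expectation (\<lambda>\<omega>. \<bar>min (X \<omega>) a - min (X \<omega>) b\<bar>)"
      by (rule integral_abs_bound)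
    also have "\<dots> \<le> expectation (\<lambda>\<omega>. \<bar>a - b\<bar>)"
      by (intro integral_mono integrable_abs Bochner_Integration.integrable_diff integrable_min_const X) auto
    finally show ?thesis
      by (simp add: dist_real_def prob_space)
  qed
  then have "1-lipschitz_on UNIV (\<lambda>s. expectation (\<lambda>\<omega>. min (X \<omega>) s))"
    by (intro lipschitz_onI) auto
  then show ?thesis
    by (rule lipschitz_on_continuous_on)
qed

text \<open>A Markov-type argument: off the event \<open>X \<le> m\<close> the integrand is at least
  \<open>min s m\<close>, and on it nonnegativity suffices. The lower bound is thus
  \<open>min s m\<close> times the probability of the complement.\<close>

lemma expectation_min_ge:
  fixes X :: "'a \<Rightarrow> real"
  assumes X: "integrable M X" "AE \<omega> in M. 0 \<le> X \<omega>"
    and "0 \<le> m" "0 \<le> s" and tail: "prob {\<omega> \<in> space M. X \<omega> \<le> m} \<le> \<delta>"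
  shows "(1 - \<delta>) * min s m \<le> expectation (\<lambda>\<omega>. min (X \<omega>) s)"
proof -
  let ?A = "{\<omega> \<in> space M. X \<omega> \<le> m}"
  let ?B = "space M - ?A"
  have [measurable]: "X \<in> borel_measurable M"
    using X(1) by (rule borel_measurable_integrable)
  have [measurable]: "?A \<in> sets M" "?B \<in> sets M"
    by measurable
  have "(1 - \<delta>) * min s m \<le> prob ?B * min s m"
    using tail assms(3,4) by (intro mult_right_mono) (auto simp: prob_compl)
  also have "\<dots> = expectation (\<lambda>\<omega>. indicator ?B \<omega> * min s m)"
    by simp
  also have "\<dots> \<le> expectation (\<lambda>\<omega>. min (X \<omega>) s)"
  proof (rule integral_mono_AE)
    show "integrable M (\<lambda>\<omega>. indicator ?B \<omega> * min s m)"
      by (simp add: integrable_real_mult_indicator emeasure_eq_measure)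
    show "integrable M (\<lambda>\<omega>. min (X \<omega>) s)"
      by (rule integrable_min_const[OF X(1)])
    show "AE \<omega> in M. indicator ?B \<omega> * min s m \<le> min (X \<omega>) s"
      using X(2) by eventually_elim (use \<open>0 \<le> s\<close> in \<open>auto simp: indicator_def\<close>)
  qed
  finally show ?thesis .
qed

lemma continuous_on_utilization:
  fixes C :: "'k::finite \<Rightarrow> 'a \<Rightarrow> real"
  assumes "\<And>i. integrable M (C i)"
  shows "continuous_on S (utilization M C)"
  unfolding utilization_def
  by (intro continuous_on_sum continuous_on_compose2[OF continuous_on_expectation_min[OF assms]]
      continuous_intros) auto

text \<open>Each \<open>min (C i \<omega>) (w $ i)\<close> is bounded by either argument: the
  allocated amounts sum to \<open>real R\<close>, the means to
  \<open>total_mean M C\<close>.\<close>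

lemma utilization_le:
  fixes C :: "'k::finite \<Rightarrow> 'a \<Rightarrow> real"
  assumes "\<And>i. integrable M (C i)" "w \<in> allocations R"
  shows "utilization M C w \<le> min (real R) (total_mean M C)"
proof (rule min.boundedI)
  have "expectation (\<lambda>\<omega>. min (C i \<omega>) (w $ i)) \<le> expectation (\<lambda>\<omega>. w $ i)" for i
    by (intro integral_mono integrable_min_const assms) auto
  then have "utilization M C w \<le> (\<Sum>i\<in>UNIV. w $ i)"
    unfolding utilization_def by (intro sum_mono) (simp add: prob_space)
  then show "utilization M C w \<le> real R"
    using assms(2) by (simp add: allocations_def)
  show "utilization M C w \<le> total_mean M C"
    unfolding utilization_def total_mean_def
    by (intro sum_mono integral_mono integrable_min_const assms) auto
qed

lemma utilization_mean_weighted_ge: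
  fixes C :: "'k::finite \<Rightarrow> 'a \<Rightarrow> real"
  assumes nonneg: "\<And>i. AE \<omega> in M. 0 \<le> C i \<omega>" and int: "\<And>i. integrable M (C i)"
    and pos: "0 < total_mean M C" and eps: "0 \<le> \<epsilon>" "\<epsilon> \<le> 1" and "\<delta> \<le> 1"
    and dev: "\<And>i. lower_deviation M \<epsilon> \<delta> (C i)"
  shows "(1 - \<delta>) * (1 - \<epsilon>) * min (real R) (total_mean M C)
    \<le> utilization M C (mean_weighted M C R)"
proof -
  \<comment> \<open>\<open>t\<close> is the common ratio of allocation to mean, the same for every
    group; this lets one factor be pulled out of the sum over groups.\<close>
  define t where "t = real R / total_mean M C"
  have t: "0 \<le> t"
    using pos by (simp add: t_def)
  have "(1 - \<delta>) * (1 - \<epsilon>) * min t 1 * expectation (C i)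
      \<le> expectation (\<lambda>\<omega>. min (C i \<omega>) (mean_weighted M C R $ i))" for i
  proof -
    let ?\<mu> = "expectation (C i)"
    have \<mu>: "0 \<le> ?\<mu>"
      by (rule integral_nonneg_AE[OF nonneg])
    have "(1 - \<epsilon>) * min t 1 \<le> min t (1 - \<epsilon>)"
    proof (rule min.boundedI)
      show "(1 - \<epsilon>) * min t 1 \<le> t"
        using mult_mono[of "1 - \<epsilon>" 1 "min t 1" t] eps t by simp
      show "(1 - \<epsilon>) * min t 1 \<le> 1 - \<epsilon>"
        using eps by (intro mult_left_le) auto
    qed
    then have "(1 - \<epsilon>) * min t 1 * ?\<mu> \<le> min t (1 - \<epsilon>) * ?\<mu>"
      using \<mu> by (rule mult_right_mono)
    then have "(1 - \<epsilon>) * min t 1 * ?\<mu> \<le> min (t * ?\<mu>) ((1 - \<epsilon>) * ?\<mu>)"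
      using \<mu> by (simp add: min_mult_distrib_right)
    then have "(1 - \<delta>) * ((1 - \<epsilon>) * min t 1 * ?\<mu>) \<le> (1 - \<delta>) * min (t * ?\<mu>) ((1 - \<epsilon>) * ?\<mu>)"
      using \<open>\<delta> \<le> 1\<close> by (intro mult_left_mono) auto
    \<comment> \<open>The tail bound is used with cap \<open>s = t * ?\<mu>\<close> and threshold
      \<open>m = (1 - \<epsilon>) * ?\<mu>\<close>, exactly the threshold of the deviation
      inequality.\<close>
    also have "\<dots> \<le> expectation (\<lambda>\<omega>. min (C i \<omega>) (t * ?\<mu>))"
      using dev[of i] eps t \<mu>
      by (intro expectation_min_ge int nonneg) (auto simp: lower_deviation_def)
    finally show ?thesis
      by (simp add: mean_weighted_def t_def mult.assoc)
  qed
  then have "(1 - \<delta>) * (1 - \<epsilon>) * min t 1 * total_mean M C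
      \<le> utilization M C (mean_weighted M C R)"
    unfolding utilization_def total_mean_def sum_distrib_left by (intro sum_mono)
  moreover have "min t 1 * total_mean M C = min (real R) (total_mean M C)"
    using pos by (simp add: t_def min_mult_distrib_right)
  ultimately show ?thesis
    by (simp add: mult.assoc)
qed

end

theorem lemma8:
  fixes M :: "'a measure" and C :: "'k::finite \<Rightarrow> 'a \<Rightarrow> real" and R :: nat and \<epsilon> \<delta> :: real
  assumes "prob_space M"
    and "prob_space.indep_vars M (\<lambda>_. borel) C UNIV"
    and "\<And>i. AE \<omega> in M. 0 \<le> C i \<omega>"
    and "\<And>i. integrable M (C i)"
    and "\<And>i. 0 < prob_space.expectation M (C i)"
    and "0 < R"
    and "0 < \<epsilon>" "\<epsilon> < 1" "0 < \<delta>" "\<delta> < 1"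
    and "\<And>i. lower_deviation M \<epsilon> \<delta> (C i)"
  shows "mean_weighted M C R \<in> allocations R \<and>
    (\<exists>w. is_arg_max (utilization M C) (\<lambda>w. w \<in> allocations R) w \<and>
      utilization M C (mean_weighted M C R) \<ge> min (1 - \<delta>) (1 - \<epsilon> - \<delta>) * utilization M C w \<and>
      min (1 - \<delta>) (1 - \<epsilon> - \<delta>) * utilization M C w = (1 - \<epsilon> - \<delta>) * utilization M C w)"
proof -
  interpret prob_space M by fact
  let ?v = "mean_weighted M C R"
  let ?Z = "total_mean M C"
  have Z: "0 < ?Z"
    unfolding total_mean_def by (intro sum_pos) (use assms(5) in auto)
  have v: "?v \<in> allocations R"
  proof -
    have "(\<Sum>i\<in>UNIV. ?v $ i) = real R * ?Z / ?Z"
      by (simp add: mean_weighted_def total_mean_def sum_distrib_left sum_divide_distrib)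
    moreover have "0 \<le> ?v $ i" for i
      using Z assms(5)[of i] by (simp add: mean_weighted_def)
    ultimately show ?thesis
      using Z by (simp add: allocations_def)
  qed
  \<comment> \<open>Extreme value theorem on the compact simplex; the mean-weighted allocation shows
    that it is nonempty.\<close>
  obtain w where w: "w \<in> allocations R"
    and max: "\<And>u. u \<in> allocations R \<Longrightarrow> utilization M C u \<le> utilization M C w"
  proof -
    have "allocations R \<noteq> ({} :: (real ^ 'k) set)"
      using v by auto
    from continuous_attains_sup[OF compact_allocations this continuous_on_utilization[of C]] assms(4)
    have "\<exists>w\<in>allocations R. \<forall>u\<in>allocations R. utilization M C u \<le> utilization M C w"
      by blast
    then show thesis
      by (elim bexE, intro that) auto
  qed
  have ge: "(1 - \<delta>) * (1 - \<epsilon>) * min (real R) ?Z \<le> utilization M C ?v"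
    by (rule utilization_mean_weighted_ge) (use assms(3,4,7-11) Z in simp_all)
  have "0 \<le> (1 - \<delta>) * (1 - \<epsilon>) * min (real R) ?Z"
    using assms(8,10) Z by simp
  \<comment> \<open>The sign matters because the next comparison of factors is multiplied by this
    utilization; \<open>w\<close> does at least as well as \<open>?v\<close>, whose lower bound is
    nonnegative.\<close>
  then have "0 \<le> utilization M C w"
    using ge max[OF v] by linarith
  \<comment> \<open>The two sides differ by \<open>\<epsilon> * \<delta>\<close>, so the product
    form of the guarantee is slightly stronger than the stated one.\<close>
  moreover have "1 - \<epsilon> - \<delta> \<le> (1 - \<delta>) * (1 - \<epsilon>)"
    using assms(7,9) by (simp add: algebra_simps)
  ultimately have "(1 - \<epsilon> - \<delta>) * utilization M C w \<le> (1 - \<delta>) * (1 - \<epsilon>) * utilization M C w"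
    by (intro mult_right_mono)
  also have "\<dots> \<le> (1 - \<delta>) * (1 - \<epsilon>) * min (real R) ?Z"
    using assms(8,10) by (intro mult_left_mono utilization_le assms(4) w) auto
  also note ge
  finally have "(1 - \<epsilon> - \<delta>) * utilization M C w \<le> utilization M C ?v" .
  moreover have "is_arg_max (utilization M C) (\<lambda>w. w \<in> allocations R) w"
    using w max by (auto simp: is_arg_max_linorder)
  moreover have "min (1 - \<delta>) (1 - \<epsilon> - \<delta>) = 1 - \<epsilon> - \<delta>"
    using assms(7) by simp
  ultimately show ?thesis
    using v by auto
qed

end
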